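(* Every ratio-covariety $\mathscr{R}$ is a finite set (of numerical semigroups).
   Context: $\mathbb{N}$ is the set of nonnegative integers. A numerical semigroup is a submonoid $S$ of $(\mathbb{N},+)$ with $\mathbb{N}\setminus S$ finite. Its multiplicity is $\mathrm{m}(S)=\min(S\setminus\{0\})$. If $S\neq\mathbb{N}$, the ratio of $S$ is $\mathrm{r}(S)=\min\{s\in S\mid \mathrm{m}(S)\nmid s\}$ (equivalently, the smallest minimal generator of $S$ different from $\mathrm{m}(S)$). A ratio-covariety is a nonempty family $\mathscr{R}$ of numerical semigroups such that: 1) $\mathscr{R}$ has a minimum with respect to inclusion, denoted $\min(\mathscr{R})$; 2) if $S,T\in\mathscr{R}$ then $S\cap T\in\mathscr{R}$; 3) if $S\in\mathscr{R}$ and $S\neq\min(\mathscr{R})$, then $S\setminus\{\mathrm{r}(S)\}\in\mathscr{R}$ (in particular $\mathrm{r}(S)$ is defined, i.e. $S\neq\mathbb{N}$). *)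

theory Defs
  imports Main
begin

definition numerical_semigroup :: "nat set \<Rightarrow> bool" where
  "numerical_semigroup S \<longleftrightarrow>
     0 \<in> S \<and> (\<forall>a\<in>S. \<forall>b\<in>S. a + b \<in> S) \<and> finite (UNIV - S)"

definition multiplicity :: "nat set \<Rightarrow> nat" where
  "multiplicity S = (LEAST s. s \<in> S - {0})"

(* Meaningful only for a numerical semigroup S other than UNIV:
   UNIV has multiplicity 1, so no element qualifies. *)
definition ratio :: "nat set \<Rightarrow> nat" where
  "ratio S = (LEAST s. s \<in> S \<and> \<not> multiplicity S dvd s)"

(* The order on nat set is inclusion, so (LEAST S. S \<in> R) is the inclusion-minimum
   of R, which exists by the conjunct preceding its use.  The conjunct S \<noteq> UNIV
   expresses that the ratio of S is defined. *)
definition ratio_covariety :: "nat set set \<Rightarrow> bool" where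
  "ratio_covariety R \<longleftrightarrow>
     R \<noteq> {} \<and>
     (\<forall>S\<in>R. numerical_semigroup S) \<and>
     (\<exists>D\<in>R. \<forall>S\<in>R. D \<subseteq> S) \<and>
     (\<forall>S\<in>R. \<forall>T\<in>R. S \<inter> T \<in> R) \<and>
     (\<forall>S\<in>R. S \<noteq> (LEAST S. S \<in> R) \<longrightarrow> S \<noteq> UNIV \<and> S - {ratio S} \<in> R)"

end

theory Submission imports Defs begin

text \<open>
  The minimum \<open>D\<close> of the family is itself a numerical semigroup, so it has only finitely many gaps.
  Every member contains \<open>D\<close>, hence its gaps form a subset of the finite set of gaps of \<open>D\<close>, and
  a set is determined by its gaps. So the family has at most as many members as the gaps of \<open>D\<close>
  have subsets.
\<close>

lemma finite_supersets_of_cofinite: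
  assumes "finite (- D)"
  shows "finite {S. D \<subseteq> S}"
proof -
  have "{S. D \<subseteq> S} \<subseteq> uminus ` Pow (- D)"
    by (auto intro: image_eqI [where x = "- S" for S])
  then show ?thesis
    using assms by (meson finite_Pow_iff finite_imageI finite_subset)
qed

theorem proposition2p2:
  fixes R :: "nat set set"
  assumes "ratio_covariety R"
  shows "finite R"
proof -
  obtain D where "D \<in> R" and D_least: "\<forall>S\<in>R. D \<subseteq> S"
    using assms unfolding ratio_covariety_def by blast
  then have "finite (- D)"
    using assms by (simp add: ratio_covariety_def numerical_semigroup_def Compl_eq_Diff_UNIV)
  then have "finite {S. D \<subseteq> S}"
    by (rule finite_supersets_of_cofinite)
  moreover have "R \<subseteq> {S. D \<subseteq> S}"
    using D_least by blast
  ultimately show ?thesis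
    by (rule rev_finite_subset)
qed

end
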